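(* For the simple $n$-polytope $P_{a_1,\dots,a_{2k-1}}$ with $n+3$ facets, $$h(P_{a_1,\dots,a_{2k-1}})(t)=\frac{1}{(t-1)^3}\left(t^{n+3}-\sum_{i=1}^{2k-1}t^{\psi_i}+\sum_{i=1}^{2k-1}t^{\varphi_i}-1\right),$$ where $\varphi_i=a_i+\dots+a_{i+k-2}$ and $\psi_i=a_i+\dots+a_{i+k-1}$, with indices taken modulo $2k-1$.
   Context: Each simple $n$-polytope with $n+3$ facets can be represented (a known fact) by a regular $(2k-1)$-gon, $k\geqslant 2$, and a surjective map from the set of facets to the set of its vertices $w_1,\dots,w_{2k-1}$ (in cyclic order), such that $n$ facets intersect in a vertex of the polytope iff the triangle formed by the images of the three remaining facets contains the center of the $(2k-1)$-gon. The polytope is denoted $P_{a_1,\dots,a_{2k-1}}$, where $a_i\geqslant 1$ is the number of facets mapped to $w_i$; $\sum_i a_i=n+3$. The $h$-polynomial of a simple $n$-polytope $P$ is $h(P)(t)=h_0t^n+h_1t^{n-1}+\dots+h_{n-1}t+h_n$, where $(h_0,\dots,h_n)$ is the $h$-vector of $P$: orienting the edges by a linear function that takes different values at the ends of every edge, $h_i$ is the number of vertices with exactly $i$ outgoing edges. *)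

theory Defs
  imports "HOL-Analysis.Analysis" "HOL-Computational_Algebra.Polynomial"
begin

definition facets :: "'a::euclidean_space set \<Rightarrow> 'a set set" where
  "facets P = {F. F facet_of P}"

definition simple_polytope :: "nat \<Rightarrow> 'a::euclidean_space set \<Rightarrow> bool" where
  "simple_polytope n P \<longleftrightarrow>
     polytope P \<and> aff_dim P = int n \<and>
     (\<forall>v. v extreme_point_of P \<longrightarrow> card {F \<in> facets P. v \<in> F} = n)"


(* An arbitrary regular m-gon in the plane with center c; its vertices
   w 0, ..., w (m - 1) may be listed counterclockwise or clockwise. *)
definition regular_polygon :: "nat \<Rightarrow> complex \<Rightarrow> (nat \<Rightarrow> complex) \<Rightarrow> bool" where
  "regular_polygon m c w \<longleftrightarrow>
     (\<exists>z. z \<noteq> 0 \<and>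
       ((\<forall>i<m. w i = c + z * cis (2 * pi * real i / real m)) \<or>
        (\<forall>i<m. w i = c + z * cis (- (2 * pi * real i / real m)))))"

(* The triangle may be degenerate (when the images of the remaining facets are
   not distinct), so it is taken to be the convex hull of the images. *)
definition polygon_representation ::
  "nat \<Rightarrow> nat \<Rightarrow> 'a::euclidean_space set \<Rightarrow> complex \<Rightarrow> (nat \<Rightarrow> complex) \<Rightarrow> ('a set \<Rightarrow> complex) \<Rightarrow> bool" where
  "polygon_representation n k P c w f \<longleftrightarrow>
     regular_polygon (2 * k - 1) c w \<and>
     f ` facets P = w ` {..<2 * k - 1} \<and>
     (\<forall>S. S \<subseteq> facets P \<and> card S = n \<longrightarrow>
        ((\<exists>v. v extreme_point_of P \<and> \<Inter>S = {v}) \<longleftrightarrow>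
         c \<in> convex hull (f ` (facets P - S))))"

(* P is a P_{a_1,...,a_{2k-1}}. Indices are residues modulo 2k - 1, represented
   by 0, ..., 2k - 2; values of a outside this range are irrelevant. *)
definition has_polygon_type ::
  "nat \<Rightarrow> nat \<Rightarrow> (nat \<Rightarrow> nat) \<Rightarrow> 'a::euclidean_space set \<Rightarrow> bool" where
  "has_polygon_type n k a P \<longleftrightarrow>
     (\<exists>c w f. polygon_representation n k P c w f \<and>
        (\<forall>i<2 * k - 1. a i = card {F \<in> facets P. f F = w i}))"


definition edge_generic :: "'a::euclidean_space set \<Rightarrow> ('a \<Rightarrow> real) \<Rightarrow> bool" where
  "edge_generic P l \<longleftrightarrow>
     linear l \<and>
     (\<forall>u v. closed_segment u v edge_of P \<longrightarrow> l u \<noteq> l v)"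

(* Every edge is oriented towards its end with the larger value of l. *)
definition outgoing_edges :: "'a::euclidean_space set \<Rightarrow> ('a \<Rightarrow> real) \<Rightarrow> 'a \<Rightarrow> 'a set set" where
  "outgoing_edges P l v = {e. e edge_of P \<and> (\<exists>u. e = closed_segment v u \<and> l v < l u)}"

definition h_vector :: "'a::euclidean_space set \<Rightarrow> ('a \<Rightarrow> real) \<Rightarrow> nat \<Rightarrow> nat" where
  "h_vector P l i = card {v. v extreme_point_of P \<and> card (outgoing_edges P l v) = i}"

definition h_polynomial :: "nat \<Rightarrow> 'a::euclidean_space set \<Rightarrow> ('a \<Rightarrow> real) \<Rightarrow> real poly" where
  "h_polynomial n P l = (\<Sum>i\<le>n. monom (of_nat (h_vector P l i)) (n - i))"


definition phi :: "nat \<Rightarrow> (nat \<Rightarrow> nat) \<Rightarrow> nat \<Rightarrow> nat" where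
  "phi k a i = (\<Sum>j = i..i + k - 2. a (j mod (2 * k - 1)))"

definition psi :: "nat \<Rightarrow> (nat \<Rightarrow> nat) \<Rightarrow> nat \<Rightarrow> nat" where
  "psi k a i = (\<Sum>j = i..i + k - 1. a (j mod (2 * k - 1)))"

end

theory Submission imports Defs begin

text \<open>
  At a vertex \<open>v\<close> of a simple \<open>n\<close>-polytope each of the \<open>n\<close> edges leaves
  exactly one of the \<open>n\<close> facets through \<open>v\<close>, so the exponent that \<open>v\<close> contributes to
  \<open>h(P)(t)\<close> is its number of descending edges. Expanding \<open>t ^ i = (1 + (t - 1)) ^ i\<close> over sets of
  descending edges at \<open>v\<close> means choosing a face with top vertex \<open>v\<close>: the facets through \<open>v\<close> whose
  edge is not chosen cut out a face of dimension the number of chosen edges. Every nonempty face has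
  exactly one top vertex (\<open>ex1_top_vertex\<close>), since the polytope lies in the cone spanned by the
  edges at any of its vertices (\<open>vertex_cone\<close>). Therefore (\<open>poly_h_polynomial_faces\<close>)
  \<open>h(P)(t)\<close> is the sum of \<open>(t - 1) ^ (n - card S)\<close> over all sets \<open>S\<close> of facets
  with a common point in \<open>P\<close>.

  By the polygon representation and Caratheodory's theorem in the plane, the facets in \<open>S\<close> have a
  common point iff the convex hull of the images of the other facets contains the center
  (\<open>nonempty_face_iff_center_in_hull\<close>). Passing to the complement \<open>T\<close> of \<open>S\<close>, which has
  \<open>n + 3 - card S\<close> elements, \<open>(t - 1) ^ 3 * h(P)(t)\<close> becomes the sum of \<open>(t - 1) ^ card T\<close> over the
  sets \<open>T\<close> of facets whose images have the center in their convex hull. Over all sets of facets this sum is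
  \<open>t ^ (n + 3)\<close>. The sets to be removed are those whose images lie on an arc of \<open>k\<close> consecutive
  vertices (\<open>center_in_hull_iff\<close>): an open half-plane bounded by a line through the center contains at most \<open>k\<close> of the \<open>2 * k - 1\<close> vertices, and they are consecutive.

  The empty set contributes \<open>1\<close>. Any other removed set has a unique first vertex \<open>i\<close>, from which all
  its images can be reached in fewer than \<open>k\<close> steps; the arc spans less than half of the cycle, so two vertices cannot both
  come first. The sets with first vertex \<open>i\<close> are the sets over the arc of length \<open>k\<close> from \<open>i\<close> that are
  not sets over the arc of length \<open>k - 1\<close> from \<open>i + 1\<close>, and they contribute
  \<open>t ^ psi i - t ^ phi (i + 1)\<close> (\<open>sum_power_card_in_arc\<close>).
\<close>

section \<open>Vertices and edges of a simple polytope\<close>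

definition vertex_facets :: "'a::euclidean_space set \<Rightarrow> 'a \<Rightarrow> 'a set set" where
  "vertex_facets P v = {F \<in> facets P. v \<in> F}"

text \<open>
  The far end of the edge that leaves the facet \<open>F\<close> at \<open>v\<close>: in a simple polytope the remaining
  facets through \<open>v\<close> cut out an edge, and every edge at \<open>v\<close> arises in this way.
\<close>

definition edge_end :: "'a::euclidean_space set \<Rightarrow> 'a \<Rightarrow> 'a set \<Rightarrow> 'a" where
  "edge_end P v F = (SOME u. closed_segment v u = P \<inter> \<Inter>(vertex_facets P v - {F}))"

text \<open>
  A minimal description of a polyhedron by half-spaces has exactly one half-space for each facet, so
  the facets themselves can index the inequalities. The normals can be chosen parallel to the affine
  hull; this allows dimension counts inside the hull when the polyhedron is not full-dimensional.
\<close>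

lemma polyhedron_facet_inequalities:
  fixes P :: "'a::euclidean_space set"
  assumes "polyhedron P" "P \<noteq> {}"
  obtains a b where
    "\<And>F x. F \<in> facets P \<Longrightarrow> x \<in> affine hull P \<Longrightarrow> x + a F \<in> affine hull P"
    "\<And>F. F \<in> facets P \<Longrightarrow> F = P \<inter> {x. a F \<bullet> x = b F}"
    "P = affine hull P \<inter> {x. \<forall>F\<in>facets P. a F \<bullet> x \<le> b F}"
proof -
  obtain H where H: "finite H" "P = affine hull P \<inter> \<Inter>H"
    and Hh: "\<forall>h\<in>H. \<exists>a b. a \<noteq> 0 \<and> h = {x. a \<bullet> x \<le> b} \<and>
                      (\<forall>x\<in>affine hull P. x + a \<in> affine hull P)"
    and Hmin: "\<forall>H'. H' \<subset> H \<longrightarrow> P \<subset> affine hull P \<inter> \<Inter>H'"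
    using assms(1) unfolding polyhedron_Int_affine_parallel_minimal[of P] by auto
  obtain a b where ab: "\<And>h. h \<in> H \<Longrightarrow> a h \<noteq> 0 \<and> h = {x. a h \<bullet> x \<le> b h}"
    and par: "\<And>h x. h \<in> H \<Longrightarrow> x \<in> affine hull P \<Longrightarrow> x + a h \<in> affine hull P"
    using Hh by metis
  have min: "\<And>H'. H' \<subset> H \<Longrightarrow> P \<subset> affine hull P \<inter> \<Inter>H'"
    using Hmin by simp
  define c where "c h = P \<inter> {x. a h \<bullet> x = b h}" for h
  have fac: "facets P = c ` H"
    unfolding facets_def c_def image_def
    by (rule Collect_cong) (use facet_of_polyhedron_explicit[OF H ab min] in auto)
  have "convex P" using assms(1) by (rule polyhedron_imp_convex)
  then obtain z where z: "z \<in> rel_interior P"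
    using assms(2) rel_interior_eq_empty by blast
  then have zP: "z \<in> P" and zless: "\<And>h. h \<in> H \<Longrightarrow> a h \<bullet> z < b h"
    using rel_interior_polyhedron_explicit[OF H ab min] by auto
  have mem: "x \<in> P \<longleftrightarrow> x \<in> affine hull P \<and> (\<forall>h\<in>H. a h \<bullet> x \<le> b h)" for x
    using H(2) ab by blast
  have inj: "inj_on c H"
  proof (rule inj_onI, rule ccontr)
    fix h h' assume h: "h \<in> H" "h' \<in> H" "c h = c h'" "h \<noteq> h'"
    have "H - {h} \<subset> H" using h by blast
    then obtain y where y: "y \<in> affine hull P" "y \<in> \<Inter>(H - {h})" "y \<notin> P"
      using psubset_imp_ex_mem[OF min[OF \<open>H - {h} \<subset> H\<close>]] by (metis DiffE IntE)
    have yle: "a g \<bullet> y \<le> b g" if "g \<in> H" "g \<noteq> h" for g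
      using y(2) that ab by blast
    then have yh: "a h \<bullet> y > b h"
      using y(1,3) mem[of y] by (metis not_le)
    \<comment> \<open>The segment from the relative interior point \<open>z\<close> to \<open>y\<close> leaves \<open>P\<close> through the
      facet of \<open>h\<close>, at a point where every other inequality is still strict.\<close>
    define s where "s = (b h - a h \<bullet> z) / (a h \<bullet> y - a h \<bullet> z)"
    have s: "0 < s" "s < 1" "s * (a h \<bullet> y - a h \<bullet> z) = b h - a h \<bullet> z"
      using yh zless[OF h(1)] by (auto simp: s_def)
    define p where "p = (1 - s) *\<^sub>R z + s *\<^sub>R y"
    have ap: "a g \<bullet> p = (1 - s) * (a g \<bullet> z) + s * (a g \<bullet> y)" for g
      by (simp add: p_def inner_add_right)
    have ph: "a h \<bullet> p = b h"
      using s(3) by (simp add: ap algebra_simps)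
    have pg: "a g \<bullet> p < b g" if "g \<in> H" "g \<noteq> h" for g
    proof -
      have "(1 - s) * (a g \<bullet> z) < (1 - s) * b g"
        using s zless[OF that(1)] by simp
      moreover have "s * (a g \<bullet> y) \<le> s * b g"
        using s yle[OF that] by simp
      ultimately show ?thesis unfolding ap by (simp add: algebra_simps)
    qed
    have "p \<in> affine hull P"
      using y(1) hull_inc[OF zP, of affine] affine_affine_hull[of P]
      unfolding p_def by (intro mem_affine) auto
    then have "p \<in> P"
      unfolding mem using ph pg by (metis less_imp_le order_refl)
    then have "p \<in> c h'" using ph h(3) by (auto simp: c_def)
    then show False using pg[OF h(2)] h(4) by (auto simp: c_def)
  qed
  define g where "g = the_inv_into H c"
  have g: "g (c h) = h" if "h \<in> H" for h
    unfolding g_def using the_inv_into_f_f[OF inj that] .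
  show thesis
  proof (rule that[of "\<lambda>F. a (g F)" "\<lambda>F. b (g F)"])
    show "\<And>F x. F \<in> facets P \<Longrightarrow> x \<in> affine hull P \<Longrightarrow> x + a (g F) \<in> affine hull P"
      using par fac g by auto
    show "\<And>F. F \<in> facets P \<Longrightarrow> F = P \<inter> {x. a (g F) \<bullet> x = b (g F)}"
      using fac g by (auto simp: c_def)
    show "P = affine hull P \<inter> {x. \<forall>F\<in>facets P. a (g F) \<bullet> x \<le> b (g F)}"
      using mem fac g by auto
  qed
qed

lemma finite_facets: "simple_polytope n P \<Longrightarrow> finite (facets P)"
  unfolding simple_polytope_def facets_def by (simp add: finite_polytope_facets)

lemma finite_vertex_facets: "simple_polytope n P \<Longrightarrow> finite (vertex_facets P v)"
  unfolding vertex_facets_def by (auto dest: finite_facets)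

lemma card_vertex_facets:
  "simple_polytope n P \<Longrightarrow> v extreme_point_of P \<Longrightarrow> card (vertex_facets P v) = n"
  unfolding vertex_facets_def simple_polytope_def by simp

text \<open>
  Intersecting with \<open>P\<close> makes the empty set of facets stand for \<open>P\<close> itself.
\<close>

lemma face_of_Int_facets:
  assumes "convex P" "S \<subseteq> facets P"
  shows "P \<inter> \<Inter>S face_of P"
proof -
  have "\<Inter>(insert P S) face_of P"
    using assms by (intro face_of_Inter) (auto simp: facets_def facet_of_imp_face_of face_of_refl)
  then show ?thesis by simp
qed

text \<open>
  The normals of the \<open>n\<close> facets through \<open>v\<close> are linearly independent on the \<open>n\<close>-dimensional direction
  space: a common zero would be a direction in which one can move from \<open>v\<close> both ways, contradicting
  extremality. Hence there is a dual basis of directions \<open>d F\<close>, each pointing into \<open>P\<close> along all the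
  facets but \<open>F\<close>. The coordinates of \<open>x - v\<close> in this basis are the slacks of the facet
  inequalities at \<open>x\<close>, which are nonnegative on \<open>P\<close> and vanish on the respective facets.
\<close>

lemma simple_vertex_edges:
  fixes P :: "'a::euclidean_space set"
  assumes P: "simple_polytope n P" and v: "v extreme_point_of P"
  obtains u where
    "\<And>F. F \<in> vertex_facets P v \<Longrightarrow>
       closed_segment v (u F) = P \<inter> \<Inter>(vertex_facets P v - {F})"
    "\<And>F. F \<in> vertex_facets P v \<Longrightarrow> u F \<notin> F"
    "\<And>x. x \<in> P \<Longrightarrow> \<exists>c. (\<forall>F\<in>vertex_facets P v. 0 \<le> c F \<and> (x \<in> F \<longrightarrow> c F = 0)) \<and>
       x - v = (\<Sum>F\<in>vertex_facets P v. c F *\<^sub>R (u F - v))"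
proof -
  define V where "V = vertex_facets P v"
  have poly: "polytope P" and dimP: "aff_dim P = int n"
    using P by (auto simp: simple_polytope_def)
  have finV: "finite V" and cardV: "card V = n" and finF: "finite (facets P)"
    using finite_vertex_facets[OF P] card_vertex_facets[OF P v] finite_facets[OF P]
    by (auto simp: V_def)
  have vP: "v \<in> P" using v by (simp add: extreme_point_of_def)
  obtain a b where par: "\<And>F x. F \<in> facets P \<Longrightarrow> x \<in> affine hull P \<Longrightarrow> x + a F \<in> affine hull P"
    and fac: "\<And>F. F \<in> facets P \<Longrightarrow> F = P \<inter> {x. a F \<bullet> x = b F}"
    and Peq: "P = affine hull P \<inter> {x. \<forall>F\<in>facets P. a F \<bullet> x \<le> b F}"
    using polyhedron_facet_inequalities[of P] polytope_imp_polyhedron[OF poly] vP by blast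
  have mem: "x \<in> P \<longleftrightarrow> x \<in> affine hull P \<and> (\<forall>F\<in>facets P. a F \<bullet> x \<le> b F)" for x
    using Peq by blast
  have on_facet: "x \<in> F \<longleftrightarrow> a F \<bullet> x = b F" if "x \<in> P" "F \<in> V" for x F
    using fac[of F] that unfolding V_def vertex_facets_def by blast
  have Vfac: "F \<in> facets P" if "F \<in> V" for F
    using that by (auto simp: V_def vertex_facets_def)
  have atv: "a F \<bullet> v = b F" if "F \<in> V" for F
    using on_facet[OF vP that] that by (simp add: V_def vertex_facets_def)
  have slack: "a F \<bullet> v < b F" if "F \<in> facets P" "F \<notin> V" for F
    using that mem[of v] vP fac[OF that(1)] unfolding V_def vertex_facets_def
    by (smt (verit) IntI mem_Collect_eq)

  define L where "L = (\<lambda>x. x - v) ` (affine hull P)"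
  have vA: "v \<in> affine hull P" using vP by (rule hull_inc)
  have subL: "subspace L"
    unfolding L_def by (rule affine_diffs_subspace_subtract[OF affine_affine_hull vA])
  have dimL: "dim L = n"
    using aff_dim_eq_dim_subtract[of v "affine hull P"] vA dimP by (simp add: L_def hull_hull)
  have memL: "w \<in> L \<longleftrightarrow> v + w \<in> affine hull P" for w
    unfolding L_def by (force simp: image_iff)
  have aL: "a F \<in> L" if "F \<in> V" for F
    using par[OF Vfac[OF that] vA] by (simp add: memL)

  \<comment> \<open>The facets that miss \<open>v\<close> impose no condition on short enough steps from \<open>v\<close>.\<close>
  have ray: "\<exists>e>0. v + e *\<^sub>R w \<in> P" if w: "w \<in> L" and le: "\<And>F. F \<in> V \<Longrightarrow> a F \<bullet> w \<le> 0" for w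
  proof -
    have "\<forall>\<^sub>F e in at_right 0. a F \<bullet> (v + e *\<^sub>R w) \<le> b F" if F: "F \<in> facets P" for F
    proof (cases "F \<in> V")
      case True
      have "\<forall>\<^sub>F e::real in at_right 0. 0 < e" by (rule eventually_at_right_less)
      then show ?thesis
      proof eventually_elim
        case (elim e)
        have "e * (a F \<bullet> w) \<le> 0" using elim le[OF True] by (simp add: mult_nonneg_nonpos)
        then show ?case using atv[OF True] by (simp add: inner_add_right)
      qed
    next
      case False
      have "((\<lambda>e. a F \<bullet> (v + e *\<^sub>R w)) \<longlongrightarrow> a F \<bullet> (v + 0 *\<^sub>R w)) (at_right 0)"
        by (intro tendsto_intros)
      then have "\<forall>\<^sub>F e in at_right 0. a F \<bullet> (v + e *\<^sub>R w) < b F"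
        using slack[OF F False] by (intro order_tendstoD(2)) auto
      then show ?thesis by eventually_elim simp
    qed
    then have "\<forall>\<^sub>F e in at_right 0. \<forall>F\<in>facets P. a F \<bullet> (v + e *\<^sub>R w) \<le> b F"
      using finF by (simp add: eventually_ball_finite)
    moreover have "\<forall>\<^sub>F e::real in at_right 0. 0 < e" by (rule eventually_at_right_less)
    ultimately have "\<forall>\<^sub>F e::real in at_right 0. 0 < e \<and> (\<forall>F\<in>facets P. a F \<bullet> (v + e *\<^sub>R w) \<le> b F)"
      by eventually_elim simp
    then obtain e :: real where e: "0 < e" "\<forall>F\<in>facets P. a F \<bullet> (v + e *\<^sub>R w) \<le> b F"
      using eventually_happens'[of "at_right (0::real)"] by auto
    have "e *\<^sub>R w \<in> L" using subL w by (rule subspace_scale)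
    then have "v + e *\<^sub>R w \<in> P" using e(2) mem memL by blast
    then show ?thesis using e(1) by blast
  qed

  have indep: "w = 0" if w: "w \<in> L" "\<And>F. F \<in> V \<Longrightarrow> a F \<bullet> w = 0" for w
  proof (rule ccontr)
    assume "w \<noteq> 0"
    obtain e1 where e1: "e1 > 0" "v + e1 *\<^sub>R w \<in> P" using ray[of w] w by auto
    obtain e2 where e2: "e2 > 0" "v + e2 *\<^sub>R (- w) \<in> P"
      using ray[of "- w"] w subspace_neg[OF subL] by auto
    have "v \<in> open_segment (v + e1 *\<^sub>R w) (v + e2 *\<^sub>R (- w))"
      unfolding in_segment
    proof (intro conjI exI[of _ "e1 / (e1 + e2)"])
      show "v + e1 *\<^sub>R w \<noteq> v + e2 *\<^sub>R (- w)"
      proof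
        assume "v + e1 *\<^sub>R w = v + e2 *\<^sub>R (- w)"
        then have "(e1 + e2) *\<^sub>R w = 0" by (simp add: scaleR_add_left)
        then show False using \<open>w \<noteq> 0\<close> e1 e2 by auto
      qed
      have "(1 - e1 / (e1 + e2)) * e1 - e1 / (e1 + e2) * e2 = 0"
        using e1 e2 by (simp add: field_simps)
      moreover have "(1 - t) *\<^sub>R (v + e1 *\<^sub>R w) + t *\<^sub>R (v + e2 *\<^sub>R - w)
        = v + ((1 - t) * e1 - t * e2) *\<^sub>R w" for t
        by (simp add: algebra_simps)
      ultimately show "v = (1 - e1 / (e1 + e2)) *\<^sub>R (v + e1 *\<^sub>R w) + (e1 / (e1 + e2)) *\<^sub>R (v + e2 *\<^sub>R - w)"
        by simp
    qed (use e1 e2 in auto)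
    then show False using v e1 e2 unfolding extreme_point_of_def by blast
  qed

  \<comment> \<open>The other \<open>n - 1\<close> normals do not span the \<open>n\<close>-dimensional space \<open>L\<close>, so they have a common
    orthogonal vector in \<open>L\<close>; by independence the normal of \<open>F\<close> does not vanish on it.\<close>
  have "\<exists>d. d \<in> L \<and> a F \<bullet> d = -1 \<and> (\<forall>G\<in>V - {F}. a G \<bullet> d = 0)" if F: "F \<in> V" for F
  proof -
    have "dim (a ` (V - {F})) \<le> card (a ` (V - {F}))"
      using finV by (intro dim_le_card') auto
    also have "\<dots> \<le> card (V - {F})" using finV by (intro card_image_le) auto
    also have "\<dots> < n" using F finV cardV by (metis card_Diff1_less)
    finally have "dim (span (a ` (V - {F}))) < dim (span L)" using dimL by (simp add: dim_span)
    moreover have "span (a ` (V - {F})) \<subseteq> span L" using aL by (intro span_mono) auto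
    ultimately have "span (a ` (V - {F})) \<subset> span L" by (metis less_irrefl psubsetI)
    then obtain x where x: "x \<noteq> 0" "x \<in> span L" "\<And>y. y \<in> span (a ` (V - {F})) \<Longrightarrow> orthogonal x y"
      using orthogonal_to_subspace_exists_gen by blast
    have xL: "x \<in> L" using x(2) subL by (metis span_eq_iff)
    have x0: "a G \<bullet> x = 0" if "G \<in> V - {F}" for G
      using x(3)[of "a G"] that by (metis imageI inner_commute orthogonal_def span_base)
    have aFx: "a F \<bullet> x \<noteq> 0"
      using indep[OF xL] x0 x(1) by (metis DiffI singletonD)
    show ?thesis
    proof (intro exI[of _ "(- 1 / (a F \<bullet> x)) *\<^sub>R x"] conjI)
      show "(- 1 / (a F \<bullet> x)) *\<^sub>R x \<in> L" using subL xL by (rule subspace_scale)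
    qed (use aFx x0 in auto)
  qed
  then obtain d where dL: "\<And>F. F \<in> V \<Longrightarrow> d F \<in> L" and dF: "\<And>F. F \<in> V \<Longrightarrow> a F \<bullet> d F = -1"
    and dG: "\<And>F G. F \<in> V \<Longrightarrow> G \<in> V \<Longrightarrow> G \<noteq> F \<Longrightarrow> a G \<bullet> d F = 0"
    by (metis DiffI singletonD)

  have coord: "x - v = (\<Sum>F\<in>V. (b F - a F \<bullet> x) *\<^sub>R d F)" if x: "x \<in> P" for x
  proof -
    let ?w = "x - v - (\<Sum>F\<in>V. (b F - a F \<bullet> x) *\<^sub>R d F)"
    have "?w \<in> L"
    proof (rule subspace_diff[OF subL])
      show "x - v \<in> L" using x by (auto simp: memL intro: hull_inc)
      show "(\<Sum>F\<in>V. (b F - a F \<bullet> x) *\<^sub>R d F) \<in> L"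
        by (intro subspace_sum[OF subL] subspace_scale[OF subL] dL)
    qed
    moreover have "a G \<bullet> ?w = 0" if G: "G \<in> V" for G
    proof -
      have "a G \<bullet> (\<Sum>F\<in>V. (b F - a F \<bullet> x) *\<^sub>R d F) = (\<Sum>F\<in>V. (b F - a F \<bullet> x) * (a G \<bullet> d F))"
        by (simp add: inner_sum_right)
      also have "\<dots> = (\<Sum>F\<in>V. if F = G then - (b G - a G \<bullet> x) else 0)"
        using dF dG G by (intro sum.cong) auto
      also have "\<dots> = - (b G - a G \<bullet> x)" using finV G by simp
      finally show ?thesis using atv[OF G] by (simp add: inner_diff_right)
    qed
    ultimately have "?w = 0" by (rule indep)
    then show ?thesis by simp
  qed

  have slack_nonneg: "0 \<le> b F - a F \<bullet> x" if "x \<in> P" "F \<in> V" for x F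
    using that mem Vfac by auto

  have "\<exists>u s. closed_segment v u = P \<inter> \<Inter>(V - {F}) \<and> u \<notin> F \<and> 0 < s \<and> u - v = s *\<^sub>R d F"
    if F: "F \<in> V" for F
  proof -
    let ?E = "P \<inter> \<Inter>(V - {F})"
    have line: "x = v + (b F - a F \<bullet> x) *\<^sub>R d F" if x: "x \<in> ?E" for x
    proof -
      have "x - v = (\<Sum>G\<in>V. if G = F then (b F - a F \<bullet> x) *\<^sub>R d F else 0)"
        unfolding coord[OF IntD1[OF x]]
      proof (intro sum.cong refl)
        fix G assume G: "G \<in> V"
        show "(b G - a G \<bullet> x) *\<^sub>R d G = (if G = F then (b F - a F \<bullet> x) *\<^sub>R d F else 0)"
          using x on_facet[of x G] G by (cases "G = F") auto
      qed
      also have "\<dots> = (b F - a F \<bullet> x) *\<^sub>R d F" using finV F by simp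
      finally show ?thesis by (simp add: algebra_simps)
    qed
    have face: "?E face_of P"
      using polytope_imp_convex[OF poly] Vfac by (intro face_of_Int_facets) auto
    have vE: "v \<in> ?E" using vP by (auto simp: V_def vertex_facets_def)
    have "compact ?E" using face polytope_imp_compact[OF poly] polytope_imp_convex[OF poly]
      by (metis face_of_imp_compact)
    moreover have "convex ?E" using face by (rule face_of_imp_convex)
    moreover have "collinear ?E"
      unfolding collinear_alt
    proof (rule exI[of _ v], rule exI[of _ "d F"], rule ballI)
      fix x assume "x \<in> ?E"
      from line[OF this] show "\<exists>r. x = v + r *\<^sub>R d F"
        by (intro exI[of _ "b F - a F \<bullet> x"])
    qed
    ultimately obtain x y where xy: "?E = closed_segment x y"
      using vE compact_convex_collinear_segment[of ?E] by blast
    have "v extreme_point_of ?E" using v vE face extreme_point_of_face by blast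
    then have "v = x \<or> v = y" unfolding xy by (simp add: extreme_point_of_segment)
    then obtain u where u: "?E = closed_segment v u"
      using xy closed_segment_commute by blast
    have "a G \<bullet> d F \<le> 0" if "G \<in> V" for G
      using dF[OF F] dG[OF F that] by (cases "G = F") auto
    then obtain e where e: "e > 0" "v + e *\<^sub>R d F \<in> P" using ray[OF dL[OF F]] by blast
    have "v + e *\<^sub>R d F \<in> ?E"
      using e dG[OF F] atv on_facet by (auto simp: inner_add_right)
    moreover have "v + e *\<^sub>R d F \<noteq> v" using e dF[OF F] by auto
    ultimately have "u \<noteq> v" using u by (metis closed_segment_idem singletonD)
    have uE: "u \<in> ?E" using u by simp
    have "b F - a F \<bullet> u \<noteq> 0" using line[OF uE] \<open>u \<noteq> v\<close> by auto
    moreover have uP: "u \<in> P" using uE by blast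
    ultimately have pos: "0 < b F - a F \<bullet> u" using slack_nonneg[OF uP F] by linarith
    have "u - v = (b F - a F \<bullet> u) *\<^sub>R d F" using line[OF uE] by (metis add_diff_cancel_left')
    moreover have "u \<notin> F" using pos on_facet[OF uP F] by auto
    ultimately show ?thesis using u pos by metis
  qed
  then obtain u s where u: "\<And>F. F \<in> V \<Longrightarrow> closed_segment v (u F) = P \<inter> \<Inter>(V - {F})"
    "\<And>F. F \<in> V \<Longrightarrow> u F \<notin> F" "\<And>F. F \<in> V \<Longrightarrow> 0 < s F" "\<And>F. F \<in> V \<Longrightarrow> u F - v = s F *\<^sub>R d F"
    by metis
  show thesis
  proof (rule that[of u, folded V_def])
    fix x assume x: "x \<in> P"
    have "x - v = (\<Sum>F\<in>V. ((b F - a F \<bullet> x) / s F) *\<^sub>R (u F - v))"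
      unfolding coord[OF x] using u(3,4) by (intro sum.cong) (auto simp: less_imp_neq[symmetric])
    moreover have "\<forall>F\<in>V. 0 \<le> (b F - a F \<bullet> x) / s F \<and> (x \<in> F \<longrightarrow> (b F - a F \<bullet> x) / s F = 0)"
      using slack_nonneg[OF x] u(3) on_facet[OF x] by (auto simp: less_imp_le)
    ultimately show "\<exists>c. (\<forall>F\<in>V. 0 \<le> c F \<and> (x \<in> F \<longrightarrow> c F = 0)) \<and>
       x - v = (\<Sum>F\<in>V. c F *\<^sub>R (u F - v))"
      by (intro exI[of _ "\<lambda>F. (b F - a F \<bullet> x) / s F"]) auto
  qed (use u in auto)
qed

lemma
  fixes P :: "'a::euclidean_space set"
  assumes P: "simple_polytope n P" and v: "v extreme_point_of P"
  shows closed_segment_edge_end: "F \<in> vertex_facets P v \<Longrightarrow>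
       closed_segment v (edge_end P v F) = P \<inter> \<Inter>(vertex_facets P v - {F})"
    and edge_end_notin: "F \<in> vertex_facets P v \<Longrightarrow> edge_end P v F \<notin> F"
    and vertex_cone: "x \<in> P \<Longrightarrow>
       \<exists>c. (\<forall>F\<in>vertex_facets P v. 0 \<le> c F \<and> (x \<in> F \<longrightarrow> c F = 0)) \<and>
         x - v = (\<Sum>F\<in>vertex_facets P v. c F *\<^sub>R (edge_end P v F - v))"
proof -
  obtain u where u: "\<And>F. F \<in> vertex_facets P v \<Longrightarrow>
       closed_segment v (u F) = P \<inter> \<Inter>(vertex_facets P v - {F})"
    "\<And>F. F \<in> vertex_facets P v \<Longrightarrow> u F \<notin> F"
    "\<And>x. x \<in> P \<Longrightarrow> \<exists>c. (\<forall>F\<in>vertex_facets P v. 0 \<le> c F \<and> (x \<in> F \<longrightarrow> c F = 0)) \<and>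
       x - v = (\<Sum>F\<in>vertex_facets P v. c F *\<^sub>R (u F - v))"
    by (rule simple_vertex_edges[OF P v, of thesis]) (rule that)
  have eq: "edge_end P v F = u F" if F: "F \<in> vertex_facets P v" for F
  proof -
    have "closed_segment v (edge_end P v F) = P \<inter> \<Inter>(vertex_facets P v - {F})"
      unfolding edge_end_def by (rule someI, rule u(1)[OF F])
    then have "{v, edge_end P v F} = {v, u F}"
      using u(1)[OF F] closed_segment_eq by metis
    then show ?thesis by (metis doubleton_eq_iff)
  qed
  show "closed_segment v (edge_end P v F) = P \<inter> \<Inter>(vertex_facets P v - {F})"
    and "edge_end P v F \<notin> F" if "F \<in> vertex_facets P v"
    using u(1,2)[OF that] eq[OF that] by auto
  show "\<exists>c. (\<forall>F\<in>vertex_facets P v. 0 \<le> c F \<and> (x \<in> F \<longrightarrow> c F = 0)) \<and>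
         x - v = (\<Sum>F\<in>vertex_facets P v. c F *\<^sub>R (edge_end P v F - v))" if "x \<in> P"
    using u(3)[OF that] by (simp add: eq cong: sum.cong)
qed

lemma vertex_facets_subset: "vertex_facets P v \<subseteq> facets P"
  by (auto simp: vertex_facets_def)

lemma in_vertex_facets: "F \<in> vertex_facets P v \<Longrightarrow> v \<in> F"
  by (auto simp: vertex_facets_def)

lemma simple_polytope_convex: "simple_polytope n P \<Longrightarrow> convex P"
  by (simp add: simple_polytope_def polytope_imp_convex)

lemma edge_end_neq:
  assumes "simple_polytope n P" "v extreme_point_of P" "F \<in> vertex_facets P v"
  shows "edge_end P v F \<noteq> v"
  using edge_end_notin[OF assms] in_vertex_facets[OF assms(3)] by auto

lemma edge_to_edge_end:
  assumes "simple_polytope n P" "v extreme_point_of P" "F \<in> vertex_facets P v"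
  shows "closed_segment v (edge_end P v F) edge_of P"
proof -
  have "closed_segment v (edge_end P v F) face_of P"
    unfolding closed_segment_edge_end[OF assms]
    using vertex_facets_subset by (intro face_of_Int_facets simple_polytope_convex[OF assms(1)]) auto
  moreover have "aff_dim (closed_segment v (edge_end P v F)) = 1"
    using edge_end_neq[OF assms] by (simp add: segment_convex_hull aff_dim_convex_hull aff_dim_2)
  ultimately show ?thesis by (simp add: edge_of_def)
qed

lemma edge_end_extreme:
  assumes "simple_polytope n P" "v extreme_point_of P" "F \<in> vertex_facets P v"
  shows "edge_end P v F extreme_point_of P"
proof -
  have "edge_end P v F extreme_point_of closed_segment v (edge_end P v F)"
    by (simp add: extreme_point_of_segment)
  then show ?thesis
    using edge_to_edge_end[OF assms] extreme_point_of_face unfolding edge_of_def by blast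
qed

lemma Int_vertex_facets:
  assumes "simple_polytope n P" "v extreme_point_of P"
  shows "P \<inter> \<Inter>(vertex_facets P v) = {v}"
proof -
  have "x = v" if x: "x \<in> P" "x \<in> \<Inter>(vertex_facets P v)" for x
  proof -
    obtain c where c: "\<forall>F\<in>vertex_facets P v. 0 \<le> c F \<and> (x \<in> F \<longrightarrow> c F = 0)"
      "x - v = (\<Sum>F\<in>vertex_facets P v. c F *\<^sub>R (edge_end P v F - v))"
      using vertex_cone[OF assms x(1)] by blast
    have "(\<Sum>F\<in>vertex_facets P v. c F *\<^sub>R (edge_end P v F - v)) = 0"
      using c(1) x(2) by (intro sum.neutral) auto
    then show ?thesis using c(2) by simp
  qed
  then show ?thesis
    using assms(2) in_vertex_facets by (auto simp: extreme_point_of_def)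
qed

text \<open>
  An edge is the intersection of the facets containing it. At least one facet \<open>F\<close> through \<open>v\<close> does not
  contain it, so it contains the edge that leaves \<open>F\<close>, and two edges of which one contains the other
  are equal.
\<close>

lemma edge_at_vertex:
  assumes P: "simple_polytope n P" and v: "v extreme_point_of P" and e: "e edge_of P" "v \<in> e"
  obtains F where "F \<in> vertex_facets P v" "e = closed_segment v (edge_end P v F)"
proof -
  let ?V = "vertex_facets P v"
  define S where "S = {F. F facet_of P \<and> e \<subseteq> F}"
  have face: "e face_of P" and dim: "aff_dim e = 1" using e by (auto simp: edge_of_def)
  have poly: "polyhedron P" using P by (simp add: simple_polytope_def polytope_imp_polyhedron)
  have SV: "S \<subseteq> ?V" using e(2) by (auto simp: S_def vertex_facets_def facets_def)
  have eq: "e = P \<inter> \<Inter>S"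
  proof (cases "e = P")
    case True
    then show ?thesis using SV by (auto simp: S_def)
  next
    case False
    then have "e = \<Inter>S"
      unfolding S_def using face_of_polyhedron[OF poly face] e(2) by auto
    then show ?thesis using face_of_imp_subset[OF face] by auto
  qed
  have "S \<noteq> ?V" using eq Int_vertex_facets[OF P v] dim by auto
  then obtain F where F: "F \<in> ?V" "F \<notin> S" using SV by blast
  let ?E = "closed_segment v (edge_end P v F)"
  have sub: "?E \<subseteq> e"
    unfolding eq closed_segment_edge_end[OF P v F(1)] using SV F(2) by blast
  have E: "?E face_of P" "aff_dim ?E = 1"
    using edge_to_edge_end[OF P v F(1)] by (auto simp: edge_of_def)
  have "?E face_of e"
    using E(1) sub face_of_imp_subset[OF face] by (rule face_of_subset)
  then have "?E = e"
    using face_of_aff_dim_lt[OF face_of_imp_convex[OF face]] E(2) dim by force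
  then show thesis using that F(1) by blast
qed

lemma ex_extreme_point_Int_facets:
  assumes P: "simple_polytope n P" and S: "S \<subseteq> facets P" "P \<inter> \<Inter>S \<noteq> {}"
  shows "\<exists>v. v extreme_point_of P \<and> S \<subseteq> vertex_facets P v"
proof -
  have face: "P \<inter> \<Inter>S face_of P"
    using simple_polytope_convex[OF P] S(1) by (rule face_of_Int_facets)
  have "compact (P \<inter> \<Inter>S)"
    using face P face_of_imp_compact simple_polytope_convex[OF P] polytope_imp_compact
    unfolding simple_polytope_def by blast
  then obtain v where "v extreme_point_of (P \<inter> \<Inter>S)"
    using extreme_point_exists_convex face_of_imp_convex[OF face] S(2) by blast
  then show ?thesis
    using extreme_point_of_face[OF face, of v] S(1) by (auto simp: vertex_facets_def)
qed

section \<open>The h-polynomial as a sum over faces\<close>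

text \<open>
  The facets through \<open>v\<close> serve as names for the edges at \<open>v\<close>; these are the facets left by the
  edges that end in \<open>v\<close>.
\<close>

definition descending_facets :: "'a::euclidean_space set \<Rightarrow> ('a \<Rightarrow> real) \<Rightarrow> 'a \<Rightarrow> 'a set set" where
  "descending_facets P l v = {F \<in> vertex_facets P v. l (edge_end P v F) < l v}"

lemma card_outgoing_edges:
  assumes P: "simple_polytope n P" and v: "v extreme_point_of P" and l: "edge_generic P l"
  shows "card (outgoing_edges P l v) = n - card (descending_facets P l v)"
proof -
  let ?V = "vertex_facets P v"
  let ?D = "descending_facets P l v"
  let ?seg = "\<lambda>F. closed_segment v (edge_end P v F)"
  have gen: "l v \<noteq> l (edge_end P v F)" if "F \<in> ?V" for F
    using l edge_to_edge_end[OF P v that] by (auto simp: edge_generic_def)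
  have "outgoing_edges P l v = ?seg ` (?V - ?D)"
  proof (intro equalityI subsetI)
    fix e assume "e \<in> outgoing_edges P l v"
    then obtain w where w: "e edge_of P" "e = closed_segment v w" "l v < l w"
      by (auto simp: outgoing_edges_def)
    then obtain F where F: "F \<in> ?V" "e = ?seg F"
      using edge_at_vertex[OF P v w(1)] by auto
    then have "{v, w} = {v, edge_end P v F}" using w(2) closed_segment_eq by metis
    then have "w = edge_end P v F" by (metis doubleton_eq_iff)
    then show "e \<in> ?seg ` (?V - ?D)" using F w(3) by (auto simp: descending_facets_def)
  next
    fix e assume "e \<in> ?seg ` (?V - ?D)"
    then obtain F where F: "F \<in> ?V" "F \<notin> ?D" "e = ?seg F" by blast
    then have "l v < l (edge_end P v F)"
      using gen[OF F(1)] by (auto simp: descending_facets_def)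
    then show "e \<in> outgoing_edges P l v"
      using F edge_to_edge_end[OF P v F(1)] by (auto simp: outgoing_edges_def)
  qed
  moreover have "inj_on ?seg (?V - ?D)"
  proof (rule inj_onI, rule ccontr)
    fix F G assume FG: "F \<in> ?V - ?D" "G \<in> ?V - ?D" "?seg F = ?seg G" "F \<noteq> G"
    have "edge_end P v F \<in> P \<inter> \<Inter>(?V - {G})"
      using FG closed_segment_edge_end[OF P v, of G] by (metis DiffD1 ends_in_segment(2))
    then show False using FG edge_end_notin[OF P v, of F] by auto
  qed
  ultimately have "card (outgoing_edges P l v) = card (?V - ?D)"
    by (simp add: card_image)
  also have "\<dots> = n - card ?D"
    using card_vertex_facets[OF P v] finite_vertex_facets[OF P]
    by (subst card_Diff_subset) (auto simp: descending_facets_def)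
  finally show ?thesis .
qed

lemma card_descending_facets_le:
  assumes P: "simple_polytope n P" and v: "v extreme_point_of P"
  shows "card (descending_facets P l v) \<le> n"
  unfolding card_vertex_facets[OF P v, symmetric] descending_facets_def
  using finite_vertex_facets[OF P] by (intro card_mono) auto

lemma finite_vertices: "simple_polytope n P \<Longrightarrow> finite {v. v extreme_point_of P}"
  by (simp add: simple_polytope_def finite_polyhedron_extreme_points polytope_imp_polyhedron)

lemma poly_h_polynomial:
  assumes P: "simple_polytope n P" and l: "edge_generic P l"
  shows "poly (h_polynomial n P l) t =
    (\<Sum>v | v extreme_point_of P. t ^ card (descending_facets P l v))"
proof -
  let ?X = "{v. v extreme_point_of P}"
  have "poly (h_polynomial n P l) t =
      (\<Sum>i\<le>n. \<Sum>v\<in>{v \<in> ?X. card (outgoing_edges P l v) = i}. t ^ (n - card (outgoing_edges P l v)))"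
    by (simp add: h_polynomial_def h_vector_def poly_sum poly_monom)
  also have "\<dots> = (\<Sum>v\<in>?X. t ^ (n - card (outgoing_edges P l v)))"
    by (rule sum.group) (auto simp: finite_vertices[OF P] card_outgoing_edges[OF P _ l])
  also have "\<dots> = (\<Sum>v\<in>?X. t ^ card (descending_facets P l v))"
    using card_descending_facets_le[OF P]
    by (intro sum.cong) (auto simp: card_outgoing_edges[OF P _ l])
  finally show ?thesis .
qed

text \<open>
  The facets in \<open>S\<close> cut out a nonempty face \<open>Q\<close>. The edges at a vertex \<open>v\<close> of \<open>Q\<close> that stay in \<open>Q\<close> are
  those leaving the facets outside \<open>S\<close>. They all descend at the vertex where \<open>l\<close> is maximal on \<open>Q\<close>, and
  local maximality in this sense implies strict global maximality, which gives uniqueness.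
\<close>

lemma ex1_top_vertex:
  fixes P :: "'a::euclidean_space set"
  assumes P: "simple_polytope n P" and l: "edge_generic P l"
    and S: "S \<subseteq> facets P" "P \<inter> \<Inter>S \<noteq> {}"
  shows "\<exists>!v. v extreme_point_of P \<and> S \<subseteq> vertex_facets P v \<and>
           vertex_facets P v - S \<subseteq> descending_facets P l v"
proof -
  let ?Q = "P \<inter> \<Inter>S"
  have lin: "linear l" using l by (simp add: edge_generic_def)
  have face: "?Q face_of P" using simple_polytope_convex[OF P] S(1) by (rule face_of_Int_facets)
  have ext: "v extreme_point_of ?Q \<longleftrightarrow> v extreme_point_of P \<and> S \<subseteq> vertex_facets P v" for v
    using extreme_point_of_face[OF face, of v] S(1)
    by (auto simp: vertex_facets_def extreme_point_of_def)
  \<comment> \<open>A vertex at which every edge inside the face descends is the strict maximum of \<open>l\<close> on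
    the face, because the face lies in the cone spanned by these edges.\<close>
  have top: "l x < l v"
    if v: "v extreme_point_of P" "S \<subseteq> vertex_facets P v"
      "vertex_facets P v - S \<subseteq> descending_facets P l v" and x: "x \<in> ?Q" "x \<noteq> v" for v x
  proof -
    let ?V = "vertex_facets P v"
    have fin: "finite ?V" using P by (rule finite_vertex_facets)
    obtain c where c: "\<And>F. F \<in> ?V \<Longrightarrow> 0 \<le> c F" "\<And>F. F \<in> ?V \<Longrightarrow> x \<in> F \<Longrightarrow> c F = 0"
      "x - v = (\<Sum>F\<in>?V. c F *\<^sub>R (edge_end P v F - v))"
      using vertex_cone[OF P v(1), of x] x(1) by blast
    have "l x - l v = (\<Sum>F\<in>?V. c F * (l (edge_end P v F) - l v))"
      using arg_cong[OF c(3), of l] lin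
      by (simp add: linear_diff linear_sum linear_cmul)
    also have "\<dots> < 0"
    proof -
      have le: "c F * (l (edge_end P v F) - l v) \<le> 0" if F: "F \<in> ?V" for F
      proof (cases "F \<in> S")
        case True
        then show ?thesis using c(2)[OF F] x(1) by auto
      next
        case False
        then have "l (edge_end P v F) - l v < 0" using v(3) F by (auto simp: descending_facets_def)
        then show ?thesis using c(1)[OF F] by (simp add: mult_nonneg_nonpos)
      qed
      obtain F where F: "F \<in> ?V" "c F \<noteq> 0"
        using c(3) x(2) by (metis (no_types, lifting) eq_iff_diff_eq_0 scale_eq_0_iff sum.neutral)
      then have "F \<notin> S" using c(2)[OF F(1)] x(1) by auto
      then have "l (edge_end P v F) - l v < 0" using v(3) F by (auto simp: descending_facets_def)
      then have "c F * (l (edge_end P v F) - l v) < 0"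
        using c(1)[OF F(1)] F(2) by (simp add: mult_pos_neg)
      then have "(\<Sum>F\<in>?V. c F * (l (edge_end P v F) - l v)) < (\<Sum>F\<in>?V. 0)"
        using fin le F(1) by (intro sum_strict_mono_ex1) auto
      then show ?thesis by simp
    qed
    finally show ?thesis by simp
  qed
  show ?thesis
  proof (rule ex_ex1I)
    let ?X = "{v. v extreme_point_of ?Q}"
    obtain w where w: "w extreme_point_of ?Q"
      using ex_extreme_point_Int_facets[OF P S] ext by blast
    have "finite ?X"
      by (rule finite_subset[OF _ finite_vertices[OF P]]) (use ext in auto)
    then have "Max (l ` ?X) \<in> l ` ?X" and le_Max: "\<And>y. y \<in> ?X \<Longrightarrow> l y \<le> Max (l ` ?X)"
      using w by (auto intro!: Max_in)
    then obtain v where v: "v \<in> ?X" and Max: "Max (l ` ?X) = l v" by (auto elim!: imageE)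
    have max: "l y \<le> l v" if "y \<in> ?X" for y using le_Max[OF that] unfolding Max .
    have vP: "v extreme_point_of P" "S \<subseteq> vertex_facets P v" using v ext by auto
    have "F \<in> descending_facets P l v" if F: "F \<in> vertex_facets P v" "F \<notin> S" for F
    proof -
      have "edge_end P v F \<in> P \<inter> \<Inter>(vertex_facets P v - {F})"
        using closed_segment_edge_end[OF P vP(1) F(1)] ends_in_segment(2) by metis
      then have "edge_end P v F \<in> ?Q" using vP(2) F(2) by blast
      then have "edge_end P v F extreme_point_of ?Q"
        using edge_end_extreme[OF P vP(1) F(1)] extreme_point_of_face[OF face] by blast
      then have "l (edge_end P v F) \<le> l v" using max by simp
      moreover have "l (edge_end P v F) \<noteq> l v"
        using l edge_to_edge_end[OF P vP(1) F(1)] unfolding edge_generic_def by metis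
      ultimately show ?thesis using F(1) by (simp add: descending_facets_def)
    qed
    then show "\<exists>v. v extreme_point_of P \<and> S \<subseteq> vertex_facets P v \<and>
        vertex_facets P v - S \<subseteq> descending_facets P l v"
      using vP by blast
  next
    fix v w
    assume v: "v extreme_point_of P \<and> S \<subseteq> vertex_facets P v \<and>
        vertex_facets P v - S \<subseteq> descending_facets P l v"
      and w: "w extreme_point_of P \<and> S \<subseteq> vertex_facets P w \<and>
        vertex_facets P w - S \<subseteq> descending_facets P l w"
    have "v \<in> ?Q" "w \<in> ?Q" using v w ext by (auto simp: extreme_point_of_def vertex_facets_def)
    then show "v = w" using top[of v w] top[of w v] v w by force
  qed
qed

lemma sum_power_card_Pow:
  fixes x :: "'a::comm_semiring_1"
  assumes "finite A"
  shows "(\<Sum>T\<in>Pow A. x ^ card T) = (1 + x) ^ card A"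
  using prod_add[OF assms, of "\<lambda>_. x" "\<lambda>_. 1"] by (simp add: add.commute)

text \<open>
  Pairs of a vertex \<open>v\<close> and a set of descending edges at \<open>v\<close> correspond to pairs of a vertex \<open>v\<close> and a set
  \<open>S\<close> of facets whose intersection has \<open>v\<close> as its top vertex. By uniqueness of the top vertex, each \<open>S\<close>
  is counted once.
\<close>

lemma poly_h_polynomial_faces:
  assumes P: "simple_polytope n P" and l: "edge_generic P l"
  shows "poly (h_polynomial n P l) t =
    (\<Sum>S | S \<subseteq> facets P \<and> P \<inter> \<Inter>S \<noteq> {}. (t - 1) ^ (n - card S))"
proof -
  let ?X = "{v. v extreme_point_of P}"
  let ?V = "vertex_facets P" and ?D = "descending_facets P l"
  let ?R = "{S. S \<subseteq> facets P \<and> P \<inter> \<Inter>S \<noteq> {}}"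
  define top where "top S v \<longleftrightarrow> v extreme_point_of P \<and> S \<subseteq> ?V v \<and> ?V v - S \<subseteq> ?D v" for S v
  have finR: "finite ?R" using finite_facets[OF P] by simp
  have D_sub: "?D v \<subseteq> ?V v" for v by (auto simp: descending_facets_def)
  have finD: "finite (?D v)" for v
    using D_sub finite_vertex_facets[OF P] by (rule finite_subset)
  have "poly (h_polynomial n P l) t = (\<Sum>v\<in>?X. \<Sum>A\<in>Pow (?D v). (t - 1) ^ card A)"
    unfolding poly_h_polynomial[OF P l] using finD by (simp add: sum_power_card_Pow)
  also have "\<dots> = (\<Sum>v\<in>?X. \<Sum>S\<in>{S \<in> ?R. top S v}. (t - 1) ^ (n - card S))"
  proof (rule sum.cong[OF refl])
    fix v assume "v \<in> ?X"
    then have v: "v extreme_point_of P" by simp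
    have nonempty: "P \<inter> \<Inter>S \<noteq> {}" if "S \<subseteq> ?V v" for S
      using that v by (force simp: vertex_facets_def extreme_point_of_def)
    show "(\<Sum>A\<in>Pow (?D v). (t - 1) ^ card A) = (\<Sum>S\<in>{S \<in> ?R. top S v}. (t - 1) ^ (n - card S))"
    proof (rule sum.reindex_bij_witness[where i = "\<lambda>S. ?V v - S" and j = "\<lambda>A. ?V v - A"])
      fix A assume A: "A \<in> Pow (?D v)"
      then have AV: "A \<subseteq> ?V v" using D_sub by blast
      then show "?V v - (?V v - A) = A" by blast
      show "?V v - A \<in> {S \<in> ?R. top S v}"
        using A v nonempty[of "?V v - A"] vertex_facets_subset[of P v] unfolding top_def by blast
      have "card (?V v - A) = n - card A" "card A \<le> n"
        using card_vertex_facets[OF P v] finite_vertex_facets[OF P, of v] AV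
          card_mono[of "?V v" A] by (auto simp: card_Diff_subset finite_subset)
      then show "(t - 1) ^ (n - card (?V v - A)) = (t - 1) ^ card A" by simp
    next
      fix S assume "S \<in> {S \<in> ?R. top S v}"
      then have "top S v" by simp
      then show "?V v - (?V v - S) = S" "?V v - S \<in> Pow (?D v)" by (auto simp: top_def)
    qed
  qed
  also have "\<dots> = (\<Sum>S\<in>?R. \<Sum>v\<in>{v \<in> ?X. top S v}. (t - 1) ^ (n - card S))"
    by (rule sum.swap_restrict[OF finite_vertices[OF P] finR])
  also have "\<dots> = (\<Sum>S\<in>?R. (t - 1) ^ (n - card S))"
  proof (rule sum.cong[OF refl])
    fix S assume S: "S \<in> ?R"
    have "\<exists>!v. top S v"
      using ex1_top_vertex[OF P l, of S] S unfolding top_def by simp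
    then obtain v where v: "\<And>w. top S w \<longleftrightarrow> w = v" by metis
    have "{v \<in> ?X. top S v} = {v}" using v by (auto simp: top_def)
    then show "(\<Sum>v\<in>{v \<in> ?X. top S v}. (t - 1) ^ (n - card S)) = (t - 1) ^ (n - card S)" by simp
  qed
  finally show ?thesis .
qed

section \<open>Arcs of a cycle\<close>

definition cyclic_arc :: "nat \<Rightarrow> nat \<Rightarrow> nat \<Rightarrow> nat set" where
  "cyclic_arc m r i = (\<lambda>s. (i + s) mod m) ` {..<r}"

lemma inj_on_add_mod:
  assumes "r \<le> m"
  shows "inj_on (\<lambda>s. (i + s) mod m) {..<r :: nat}"
proof (rule inj_onI)
  have le: "s = t" if "s < r" "t < r" "(i + s) mod m = (i + t) mod m" "s \<le> t" for s t
  proof -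
    have "m dvd (i + t) - (i + s)"
      using that(3,4) mod_eq_dvd_iff_nat[of "i + s" "i + t" m] by simp
    then show ?thesis using that assms by (auto dest: dvd_imp_le)
  qed
  fix s t assume "s \<in> {..<r}" "t \<in> {..<r}" "(i + s) mod m = (i + t) mod m"
  then show "s = t" using le[of s t] le[of t s] by (cases "s \<le> t") auto
qed

lemma card_vimage_cyclic_arc:
  assumes A: "finite A" and r: "r \<le> m"
  shows "card {F \<in> A. g F \<in> cyclic_arc m r i} = (\<Sum>s<r. card {F \<in> A. g F = (i + s) mod m})"
proof -
  have "{F \<in> A. g F \<in> cyclic_arc m r i} = (\<Union>s<r. {F \<in> A. g F = (i + s) mod m})"
    by (auto simp: cyclic_arc_def)
  also have "card \<dots> = (\<Sum>s<r. card {F \<in> A. g F = (i + s) mod m})"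
    using A inj_on_add_mod[OF r, of i]
    by (intro card_UN_disjoint) (auto dest: inj_onD)
  finally show ?thesis .
qed

lemma cyclic_arc_insert:
  assumes "0 < r"
  shows "cyclic_arc m r i = insert (i mod m) (cyclic_arc m (r - 1) (Suc i))"
proof -
  have "{..<r} = insert 0 (Suc ` {..<r - 1})"
    using lessThan_Suc_eq_insert_0[of "r - 1"] assms by simp
  then show ?thesis by (simp add: cyclic_arc_def image_image)
qed

lemma start_notin_cyclic_arc:
  assumes "r < m"
  shows "i mod m \<notin> cyclic_arc m r (Suc i)"
proof
  assume "i mod m \<in> cyclic_arc m r (Suc i)"
  then obtain s where s: "s < r" "(i + Suc s) mod m = (i + 0) mod m"
    by (auto simp: cyclic_arc_def)
  have "Suc s = 0"
    by (rule inj_onD[OF inj_on_add_mod[OF order_refl, of i m] s(2)]) (use s(1) assms in auto)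
  then show False by simp
qed

text \<open>
  Fewer than \<open>r\<close> steps from \<open>i\<close> to \<open>j\<close> followed by fewer than \<open>r\<close> steps back to \<open>i\<close> do not suffice to go
  around a cycle of \<open>m \<ge> 2 * r - 1\<close> vertices.
\<close>

lemma first_vertex_unique:
  assumes "2 * r \<le> m + 1" and i: "i < m" "j \<in> cyclic_arc m r i" and j: "j < m" "i \<in> cyclic_arc m r j"
  shows "i = j"
proof -
  obtain s where s: "s < r" "j = (i + s) mod m" using i by (auto simp: cyclic_arc_def)
  obtain t where t: "t < r" "i = (j + t) mod m" using j by (auto simp: cyclic_arc_def)
  have "(i + (s + t)) mod m = (i + 0) mod m"
  proof -
    have "(i + (s + t)) mod m = ((i + s) mod m + t) mod m"
      by (simp add: mod_add_left_eq add.assoc)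
    also have "\<dots> = i" using s(2) t(2) by simp
    finally show ?thesis using i(1) by simp
  qed
  then have "s + t = 0"
    by (rule inj_onD[OF inj_on_add_mod[OF order_refl]]) (use s(1) t(1) i(1) assms(1) in auto)
  then show ?thesis using s(2) i(1) by simp
qed

lemma first_vertex_exists:
  assumes "U \<subseteq> cyclic_arc m r i0" "U \<noteq> {}"
  shows "\<exists>i\<in>U. U \<subseteq> cyclic_arc m r i"
proof -
  let ?P = "\<lambda>s. (i0 + s) mod m \<in> U"
  obtain s1 where "?P s1" using assms by (auto simp: cyclic_arc_def)
  then have P: "?P (LEAST s. ?P s)" by (rule LeastI)
  define s0 where "s0 = (LEAST s. ?P s)"
  have "j \<in> cyclic_arc m r ((i0 + s0) mod m)" if j: "j \<in> U" for j
  proof -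
    obtain s where s: "s < r" "j = (i0 + s) mod m" using assms(1) j by (auto simp: cyclic_arc_def)
    have "s0 \<le> s" unfolding s0_def using j s(2) by (intro Least_le) simp
    then obtain d where d: "s = s0 + d" using le_Suc_ex by blast
    then have "j = ((i0 + s0) mod m + d) mod m"
      using s(2) by (simp add: mod_add_left_eq add.assoc)
    then show ?thesis using s(1) d by (auto simp: cyclic_arc_def)
  qed
  then show ?thesis using P unfolding s0_def by blast
qed

text \<open>
  The nonempty sets in question are grouped by the first vertex of their image. Those with first
  vertex \<open>i\<close> are the sets over the arc from \<open>i\<close> minus the sets over the rest of that arc, and for each
  arc the sum over all sets above it is a power of \<open>1 + x\<close>.
\<close>

lemma sum_power_card_in_arc:
  fixes x :: "'a::comm_ring_1"
  assumes A: "finite A" and g: "g ` A \<subseteq> {..<m}" and r: "0 < r" "2 * r \<le> m + 1"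
  shows "(\<Sum>T | T \<subseteq> A \<and> (\<exists>i<m. g ` T \<subseteq> cyclic_arc m r i). x ^ card T) =
    1 + (\<Sum>i<m. (1 + x) ^ card {F \<in> A. g F \<in> cyclic_arc m r i} -
                 (1 + x) ^ card {F \<in> A. g F \<in> cyclic_arc m (r - 1) (Suc i)})"
proof -
  let ?arc = "cyclic_arc m r" and ?rest = "\<lambda>i. cyclic_arc m (r - 1) (Suc i)"
  let ?in = "\<lambda>W. {F \<in> A. g F \<in> W}"
  define B where "B i = {T. T \<subseteq> A \<and> i \<in> g ` T \<and> g ` T \<subseteq> ?arc i}" for i
  have finB: "finite (B i)" for i
    by (rule finite_subset[of _ "Pow A"]) (use A in \<open>auto simp: B_def\<close>)
  have m: "0 < m" "r \<le> m" using r by auto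
  have B_eq: "B i = Pow (?in (?arc i)) - Pow (?in (?rest i))" if i: "i < m" for i
  proof -
    have arc: "?arc i = insert i (?rest i)" using cyclic_arc_insert[OF r(1), of m i] i by simp
    have "i \<notin> ?rest i" using start_notin_cyclic_arc[of "r - 1" m i] m r(1) i by simp
    then show ?thesis unfolding B_def arc by blast
  qed
  have sumB: "(\<Sum>T\<in>B i. x ^ card T) = (1 + x) ^ card (?in (?arc i)) - (1 + x) ^ card (?in (?rest i))"
    if i: "i < m" for i
  proof -
    have "?in (?rest i) \<subseteq> ?in (?arc i)" using cyclic_arc_insert[OF r(1), of m i] by auto
    then have "Pow (?in (?rest i)) \<subseteq> Pow (?in (?arc i))" by (rule Pow_mono)
    then show ?thesis
      unfolding B_eq[OF i] using A by (simp add: sum_diff sum_power_card_Pow)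
  qed
  have disj: "B i \<inter> B j = {}" if "i < m" "j < m" "i \<noteq> j" for i j
    using first_vertex_unique[OF r(2), of i j] that unfolding B_def by blast
  have "{T. T \<subseteq> A \<and> (\<exists>i<m. g ` T \<subseteq> ?arc i)} = insert {} (\<Union>i<m. B i)"
  proof (intro equalityI subsetI)
    fix T assume "T \<in> {T. T \<subseteq> A \<and> (\<exists>i<m. g ` T \<subseteq> ?arc i)}"
    then obtain i0 where T: "T \<subseteq> A" "g ` T \<subseteq> ?arc i0" by blast
    show "T \<in> insert {} (\<Union>i<m. B i)"
    proof (cases "T = {}")
      case False
      then obtain i where "i \<in> g ` T" "g ` T \<subseteq> ?arc i"
        using first_vertex_exists[OF T(2)] by auto
      moreover from this have "i < m" using g T(1) by auto
      ultimately show ?thesis using T(1) by (auto simp: B_def)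
    qed simp
  qed (use m in \<open>auto simp: B_def\<close>)
  also have "(\<Sum>T\<in>\<dots>. x ^ card T) = 1 + (\<Sum>T\<in>(\<Union>i<m. B i). x ^ card T)"
    using finB by (subst sum.insert) (auto simp: B_def)
  also have "(\<Sum>T\<in>(\<Union>i<m. B i). x ^ card T) = (\<Sum>i<m. \<Sum>T\<in>B i. x ^ card T)"
    using finB disj by (intro sum.UNION_disjoint) auto
  finally show ?thesis using sumB by simp
qed

lemma phi_shift:
  assumes "k \<ge> 2"
  shows "phi k a i = (\<Sum>s<k - 1. a ((i + s) mod (2 * k - 1)))"
  unfolding phi_def
  by (rule sum.reindex_bij_witness[where i = "\<lambda>s. i + s" and j = "\<lambda>j. j - i"]) (use assms in auto)

lemma psi_shift:
  assumes "k \<ge> 1"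
  shows "psi k a i = (\<Sum>s<k. a ((i + s) mod (2 * k - 1)))"
  unfolding psi_def
  by (rule sum.reindex_bij_witness[where i = "\<lambda>s. i + s" and j = "\<lambda>j. j - i"]) (use assms in auto)

lemma sum_phi_Suc:
  fixes t :: "'a::comm_semiring_1"
  assumes "k \<ge> 2"
  shows "(\<Sum>i<2 * k - 1. t ^ phi k a (Suc i)) = (\<Sum>i<2 * k - 1. t ^ phi k a i)"
proof -
  let ?m = "2 * k - 1"
  have "phi k a ?m = phi k a 0"
    unfolding phi_shift[OF assms] mod_add_self1 by simp
  moreover have "Suc (?m - 1) = ?m" using assms by simp
  ultimately show ?thesis
    using sum.lessThan_Suc[of "\<lambda>i. t ^ phi k a (Suc i)" "?m - 1"]
      sum.lessThan_Suc_shift[of "\<lambda>i. t ^ phi k a i" "?m - 1"]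
    by (simp add: add.commute)
qed

section \<open>The center of a regular polygon\<close>

lemma inner_rcis: "inner (rcis r \<alpha>) (rcis s \<beta>) = r * s * cos (\<beta> - \<alpha>)"
  by (simp add: inner_complex_def rcis_def cos_diff algebra_simps)

lemma regular_polygon_oriented:
  assumes "regular_polygon m c w"
  obtains \<rho> \<gamma> \<sigma> where "\<rho> > 0" "\<sigma> = 1 \<or> \<sigma> = - 1"
    "\<And>j. j < m \<Longrightarrow> w j - c = rcis \<rho> (\<gamma> + \<sigma> * (2 * pi * real j / real m))"
proof -
  obtain z where z: "z \<noteq> 0"
    "(\<forall>i<m. w i = c + z * cis (2 * pi * real i / real m)) \<or>
     (\<forall>i<m. w i = c + z * cis (- (2 * pi * real i / real m)))"
    using assms by (auto simp: regular_polygon_def)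
  have rot: "z * cis x = rcis (cmod z) (Arg z + x)" for x
    by (metis rcis_cmod_Arg cis_rcis_eq rcis_mult mult.right_neutral)
  from z(2) show thesis
  proof
    assume "\<forall>i<m. w i = c + z * cis (2 * pi * real i / real m)"
    then show thesis using z(1) by (intro that[of "cmod z" 1 "Arg z"]) (auto simp: rot)
  next
    assume "\<forall>i<m. w i = c + z * cis (- (2 * pi * real i / real m))"
    then show thesis using z(1) by (intro that[of "cmod z" "-1" "Arg z"]) (auto simp: rot)
  qed
qed

text \<open>
  Projecting the vertices to a line through the center gives equidistant samples of a cosine. As the cosine is
  even, this description does not depend on the orientation of the polygon.
\<close>

lemma inner_regular_polygon:
  assumes "regular_polygon m c w"
  shows "q \<noteq> 0 \<Longrightarrow> \<exists>R \<theta>. R > 0 \<and> (\<forall>j<m. inner q (w j - c) = R * cos (2 * pi * real j / real m - \<theta>))"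
    and "\<exists>q R. R > 0 \<and> (\<forall>j<m. inner q (w j - c) = R * cos (2 * pi * real j / real m - \<theta>))"
proof -
  obtain \<rho> \<gamma> \<sigma> where w: "\<rho> > 0" "\<sigma> = 1 \<or> \<sigma> = - 1"
    "\<And>j. j < m \<Longrightarrow> w j - c = rcis \<rho> (\<gamma> + \<sigma> * (2 * pi * real j / real m))"
    by (rule regular_polygon_oriented[OF assms]) (rule that)
  have proj: "inner (rcis r (\<gamma> + \<sigma> * \<theta>)) (w j - c) = r * \<rho> * cos (2 * pi * real j / real m - \<theta>)"
    if "j < m" for r \<theta> j
  proof -
    have "\<gamma> + \<sigma> * (2 * pi * real j / real m) - (\<gamma> + \<sigma> * \<theta>) = \<sigma> * (2 * pi * real j / real m - \<theta>)"
      by (simp add: algebra_simps)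
    moreover have "cos (\<sigma> * y) = cos y" for y using w(2) by auto
    ultimately show ?thesis unfolding w(3)[OF that] inner_rcis by metis
  qed
  show "\<exists>R \<theta>. R > 0 \<and> (\<forall>j<m. inner q (w j - c) = R * cos (2 * pi * real j / real m - \<theta>))"
    if "q \<noteq> 0"
  proof -
    have "\<gamma> + \<sigma> * (\<sigma> * (Arg q - \<gamma>)) = Arg q" using w(2) by auto
    then have "q = rcis (cmod q) (\<gamma> + \<sigma> * (\<sigma> * (Arg q - \<gamma>)))" by (simp add: rcis_cmod_Arg)
    then show ?thesis
      using proj[of _ "cmod q" "\<sigma> * (Arg q - \<gamma>)"] w(1) that
      by (intro exI[of _ "cmod q * \<rho>"] exI[of _ "\<sigma> * (Arg q - \<gamma>)"]) auto
  qed
  show "\<exists>q R. R > 0 \<and> (\<forall>j<m. inner q (w j - c) = R * cos (2 * pi * real j / real m - \<theta>))"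
    using proj[of _ 1 \<theta>] w(1) by (intro exI[of _ "rcis 1 (\<gamma> + \<sigma> * \<theta>)"] exI[of _ \<rho>]) auto
qed

lemma regular_polygon_inj:
  assumes "regular_polygon m c w"
  shows "inj_on w {..<m}"
proof (cases "m = 0")
  case False
  then have inj: "inj_on (\<lambda>j. cis (2 * pi * real j / real m)) {..<m}"
    using Complex.bij_betw_roots_unity[of m] by (simp add: bij_betw_def)
  obtain z where z: "z \<noteq> 0"
    "(\<forall>i<m. w i = c + z * cis (2 * pi * real i / real m)) \<or>
     (\<forall>i<m. w i = c + z * cis (- (2 * pi * real i / real m)))"
    using assms by (auto simp: regular_polygon_def)
  show ?thesis
  proof (rule inj_onI)
    fix i j assume ij: "i \<in> {..<m}" "j \<in> {..<m}" "w i = w j"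
    have "cis (2 * pi * real i / real m) = cis (2 * pi * real j / real m)"
      using z(2)
    proof
      assume "\<forall>i<m. w i = c + z * cis (2 * pi * real i / real m)"
      then show ?thesis using ij z(1) by auto
    next
      assume "\<forall>i<m. w i = c + z * cis (- (2 * pi * real i / real m))"
      then have "cnj (cis (2 * pi * real i / real m)) = cnj (cis (2 * pi * real j / real m))"
        using ij z(1) by (simp add: cis_cnj)
      then show ?thesis by (simp only: complex_cnj_cancel_iff)
    qed
    then show "i = j" using inj ij(1,2) by (auto dest: inj_onD)
  qed
qed simp

lemma cos_pos_imp_near_period:
  assumes "cos y > 0"
  obtains r :: int where "\<bar>y + 2 * pi * of_int r\<bar> < pi / 2"
proof -
  define r where "r = - \<lfloor>(y + pi) / (2 * pi)\<rfloor>"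
  define y' where "y' = y + 2 * pi * of_int r"
  have "of_int (- r) \<le> (y + pi) / (2 * pi)" "(y + pi) / (2 * pi) < of_int (- r) + 1"
    by (simp_all add: r_def)
  then have "\<bar>y'\<bar> \<le> pi"
    by (auto simp: y'_def field_simps abs_le_iff)
  moreover have "cos \<bar>y'\<bar> = cos y"
    using cos_int_2pin[of r] sin_int_2pin[of r] by (simp add: y'_def cos_add)
  ultimately have "\<bar>y'\<bar> < pi / 2"
    using assms cos_monotone_0_pi_le[of "pi/2" "\<bar>y'\<bar>"] by (cases "\<bar>y'\<bar> < pi / 2") auto
  then show thesis using that y'_def by blast
qed

text \<open>
  The \<open>k\<close> vertices of the arc span an angle of \<open>2 * pi * (k - 1) / (2 * k - 1) < pi\<close>, so they lie in an open
  half-plane bounded by a line through the center.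
\<close>

lemma arc_misses_center:
  assumes reg: "regular_polygon (2 * k - 1) c w" and k: "k \<ge> 1"
    and U: "U \<subseteq> cyclic_arc (2 * k - 1) k i"
  shows "c \<notin> convex hull (w ` U)"
proof -
  define m where "m = 2 * k - 1"
  have m: "real m = 2 * real k - 1" "m > 0" using k by (auto simp: m_def)
  \<comment> \<open>The normal of the half-plane points to the middle of the arc.\<close>
  define \<theta> where "\<theta> = 2 * pi * (real i + (real k - 1) / 2) / real m"
  obtain q R where q: "R > 0"
    "\<And>j. j < m \<Longrightarrow> inner q (w j - c) = R * cos (2 * pi * real j / real m - \<theta>)"
    using inner_regular_polygon(2)[OF reg, of \<theta>] unfolding m_def by blast
  have pos: "inner q (w j - c) > 0" if j: "j \<in> U" for j
  proof -
    obtain s where s: "s < k" "j = (i + s) mod m"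
      using U j by (auto simp: cyclic_arc_def m_def)
    define e where "e = (i + s) div m"
    have js: "real i + real s = real j + real m * real e"
      using div_mult_mod_eq[of "i + s" m] unfolding s(2) e_def
      by (metis add.commute mult.commute of_nat_add of_nat_mult)
    define y where "y = 2 * pi * (real s - (real k - 1) / 2) / real m"
    have "2 * pi * real j / real m - \<theta> = 2 * pi * (real j - real i - (real k - 1) / 2) / real m"
      by (simp add: \<theta>_def diff_divide_distrib add_divide_distrib algebra_simps)
    also have "real j - real i - (real k - 1) / 2 = real s - (real k - 1) / 2 - real m * real e"
      using js by simp
    also have "2 * pi * (real s - (real k - 1) / 2 - real m * real e) / real m
        = y - 2 * pi * of_int (int e)"
      using m(2) by (simp add: y_def field_simps)
    finally have "cos (2 * pi * real j / real m - \<theta>) = cos y"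
      using cos_int_2pin[of "int e"] sin_int_2pin[of "int e"] by (simp add: cos_diff)
    moreover have "cos y > 0"
    proof -
      have "\<bar>y\<bar> = 2 * pi / real m * \<bar>real s - (real k - 1) / 2\<bar>"
        by (simp add: y_def abs_mult)
      also have "\<dots> \<le> 2 * pi / real m * ((real k - 1) / 2)"
        using s(1) by (intro mult_left_mono) (auto simp: abs_le_iff field_simps)
      also have "\<dots> = pi * ((real k - 1) / real m)" by simp
      also have "\<dots> < pi * (1 / 2)"
      proof (rule mult_strict_left_mono)
        show "(real k - 1) / real m < 1 / 2" using m by (subst pos_divide_less_eq) auto
      qed simp
      finally show ?thesis by (intro cos_gt_zero_pi) auto
    qed
    moreover have "j < m" using s(2) m(2) by simp
    ultimately show ?thesis using q by simp
  qed
  have "convex hull (w ` U) \<subseteq> {x. inner q x > inner q c}"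
    using pos by (intro hull_minimal convex_halfspace_gt) (auto simp: inner_diff_right)
  then show ?thesis by auto
qed

text \<open>
  A line through the center strictly separates it from the points, so the angles of the points lie in an open
  interval of length \<open>pi\<close>. This is \<open>k - 1 / 2\<close> times the angle between adjacent vertices, and
  an open interval of length \<open>k - 1 / 2\<close> contains at most \<open>k\<close> integers.
\<close>

lemma missing_center_imp_arc:
  assumes reg: "regular_polygon (2 * k - 1) c w" and k: "k \<ge> 1"
    and U: "U \<subseteq> {..<2 * k - 1}" and c: "c \<notin> convex hull (w ` U)"
  shows "\<exists>i<2 * k - 1. U \<subseteq> cyclic_arc (2 * k - 1) k i"
proof (cases "U = {}")
  case True
  then show ?thesis using k by (auto intro!: exI[of _ 0])
next
  case False
  define m where "m = 2 * k - 1"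
  have m: "real m = 2 * real k - 1" "m > 0" using k by (auto simp: m_def)
  have "finite U" using U finite_subset by blast
  then have "compact (convex hull (w ` U))"
    by (intro compact_convex_hull finite_imp_compact) auto
  then obtain q b where q: "inner q c < b" "\<And>x. x \<in> convex hull (w ` U) \<Longrightarrow> b < inner q x"
    using separating_hyperplane_closed_point[OF convex_convex_hull compact_imp_closed c] by blast
  have pos: "inner q (w j - c) > 0" if "j \<in> U" for j
    using q(1) q(2)[of "w j"] hull_inc[of "w j" "w ` U" convex] that
    by (simp add: inner_diff_right)
  then have "q \<noteq> 0" using False by auto
  then obtain R \<theta> where R: "R > 0"
    "\<And>j. j < m \<Longrightarrow> inner q (w j - c) = R * cos (2 * pi * real j / real m - \<theta>)"
    using inner_regular_polygon(1)[OF reg] unfolding m_def by metis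
  \<comment> \<open>In units of the angle between adjacent vertices, the open half-circle is an open
    interval of length \<open>m / 2 = k - 1 / 2\<close> with left end \<open>x\<close>.\<close>
  define x where "x = real m * \<theta> / (2 * pi) - real m / 4"
  define i0 where "i0 = \<lfloor>x\<rfloor> + 1"
  define i where "i = nat (i0 mod int m)"
  have i: "int i = i0 mod int m" using m(2) by (simp add: i_def)
  have "j \<in> cyclic_arc m k i" if j: "j \<in> U" for j
  proof -
    have jm: "j < m" using U j by (auto simp: m_def)
    have "cos (2 * pi * real j / real m - \<theta>) > 0"
      using pos[OF j] R jm by (simp add: zero_less_mult_iff)
    then obtain r :: int where r: "\<bar>2 * pi * real j / real m - \<theta> + 2 * pi * of_int r\<bar> < pi / 2"
      using cos_pos_imp_near_period by blast
    define J where "J = int j + r * int m"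
    have "2 * pi / real m * (real_of_int J - real m * \<theta> / (2 * pi))
        = 2 * pi * real j / real m - \<theta> + 2 * pi * of_int r"
      using m(2) by (simp add: J_def field_simps)
    then have "2 * pi / real m * \<bar>real_of_int J - real m * \<theta> / (2 * pi)\<bar> < pi / 2"
      using r abs_mult[of "2 * pi / real m" "real_of_int J - real m * \<theta> / (2 * pi)"] by simp
    then have "\<bar>real_of_int J - real m * \<theta> / (2 * pi)\<bar> < real m / 4"
      using m(2) by (simp add: field_simps)
    then have J: "x < real_of_int J" "real_of_int J < x + real k - 1 / 2"
      using m(1) unfolding x_def abs_less_iff by linarith+
    have "i0 \<le> J" using J(1) unfolding i0_def by linarith
    moreover have "J < i0 + int k" using J(2) unfolding i0_def by linarith
    ultimately obtain s where s: "s < k" "J = i0 + int s"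
      by (metis add_diff_cancel_left' add_less_cancel_left nonneg_int_cases of_nat_less_iff
          le_add_diff_inverse diff_ge_0_iff_ge)
    have "int ((i + s) mod m) = (i0 mod int m + int s) mod int m"
      by (simp add: i zmod_int)
    also have "\<dots> = J mod int m" by (simp add: s(2) mod_add_left_eq)
    also have "\<dots> = int j" using jm by (simp add: J_def)
    finally have "j = (i + s) mod m" by simp
    then show ?thesis using s(1) by (auto simp: cyclic_arc_def)
  qed
  moreover have "i < m" using m(2) by (simp add: i_def nat_less_iff)
  ultimately show ?thesis by (auto simp: m_def)
qed

lemma center_in_hull_iff:
  assumes "regular_polygon (2 * k - 1) c w" "k \<ge> 1" "U \<subseteq> {..<2 * k - 1}"
  shows "c \<in> convex hull (w ` U) \<longleftrightarrow> \<not> (\<exists>i<2 * k - 1. U \<subseteq> cyclic_arc (2 * k - 1) k i)"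
  using arc_misses_center[OF assms(1,2)] missing_center_imp_arc[OF assms] by blast

section \<open>Faces of the polytope and the center of the polygon\<close>

text \<open>
  A polygon with an odd number of vertices has no two opposite vertices; of the two arcs between two
  vertices, the shorter one has at most \<open>k\<close> vertices. Caratheodory's theorem bounds the number of
  points that are needed only from above; this excludes fewer than three.
\<close>

lemma two_vertices_miss_center:
  assumes reg: "regular_polygon (2 * k - 1) c w" and k: "k \<ge> 2"
    and U: "U \<subseteq> {..<2 * k - 1}" "card U \<le> 2"
  shows "c \<notin> convex hull (w ` U)"
proof -
  let ?m = "2 * k - 1"
  have mem: "(i + s) mod ?m \<in> cyclic_arc ?m k i" if "s < k" for i s
    using that by (auto simp: cyclic_arc_def)
  have arc: "\<exists>i<?m. {p, q} \<subseteq> cyclic_arc ?m k i" if pq: "p \<le> q" "q < ?m" for p q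
  proof (cases "q < p + k")
    case True
    have "p = (p + 0) mod ?m" "q = (p + (q - p)) mod ?m" using pq by auto
    then have "{p, q} \<subseteq> cyclic_arc ?m k p"
      using mem[of 0 p] mem[of "q - p" p] True k pq by auto
    then show ?thesis using pq by (intro exI[of _ p]) auto
  next
    \<comment> \<open>Going around the other way from \<open>q\<close> to \<open>p\<close> takes fewer than \<open>k\<close> steps.\<close>
    case False
    have "q + (p + ?m - q) = p + ?m" using pq by simp
    then have "(q + (p + ?m - q)) mod ?m = p" using pq by (simp only: mod_add_self2 mod_less)
    moreover have "(q + 0) mod ?m = q" using pq by simp
    moreover have "p + ?m - q < k" using False pq by linarith
    ultimately have "{p, q} \<subseteq> cyclic_arc ?m k q"
      using mem[of 0 q] mem[of "p + ?m - q" q] k by auto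
    then show ?thesis using pq by (intro exI[of _ q]) auto
  qed
  have fin: "finite U" using U(1) finite_subset by blast
  have "\<exists>i<?m. U \<subseteq> cyclic_arc ?m k i"
  proof (cases "U = {}")
    case True
    then show ?thesis using k by (auto intro!: exI[of _ 0])
  next
    case False
    have "U \<subseteq> {Min U, Max U}"
    proof
      fix u assume u: "u \<in> U"
      show "u \<in> {Min U, Max U}"
      proof (rule ccontr)
        assume "u \<notin> {Min U, Max U}"
        then have "Min U < u" "u < Max U"
          using Min_le[OF fin u] Max_ge[OF fin u] by auto
        then have "card {Min U, u, Max U} = 3" by simp
        moreover have "card {Min U, u, Max U} \<le> card U"
          using fin False u by (intro card_mono) auto
        ultimately show False using U(2) by simp
      qed
    qed
    moreover have "Min U \<le> Max U" "Max U < ?m"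
      using fin False U(1) by (auto intro: Max_in)
    ultimately show ?thesis using arc[of "Min U" "Max U"] by blast
  qed
  then show ?thesis using center_in_hull_iff[OF reg _ U(1)] k by simp
qed

text \<open>
  The representation speaks only about sets of \<open>n\<close> facets. A nonempty face contains a vertex, whose \<open>n\<close> facets include
  \<open>S\<close>. Conversely, Caratheodory's theorem yields three facets outside \<open>S\<close> whose triangle contains the center,
  and the \<open>n\<close> facets other than these meet in a vertex, which lies in all facets of \<open>S\<close>.
\<close>

lemma nonempty_face_iff_center_in_hull:
  assumes P: "simple_polytope n P" and card: "card (facets P) = n + 3" and k: "k \<ge> 2"
    and rep: "polygon_representation n k P c w f" and S: "S \<subseteq> facets P"
  shows "P \<inter> \<Inter>S \<noteq> {} \<longleftrightarrow> c \<in> convex hull (f ` (facets P - S))"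
proof
  have reg: "regular_polygon (2 * k - 1) c w" and im: "f ` facets P = w ` {..<2 * k - 1}"
    and vertex: "\<And>S. S \<subseteq> facets P \<Longrightarrow> card S = n \<Longrightarrow>
      (\<exists>v. v extreme_point_of P \<and> \<Inter>S = {v}) \<longleftrightarrow> c \<in> convex hull (f ` (facets P - S))"
    using rep by (auto simp: polygon_representation_def)
  have fin: "finite (facets P)" using P by (rule finite_facets)
  have in_P: "F \<subseteq> P" if "F \<in> facets P" for F
    using that by (auto simp: facets_def dest: facet_of_imp_subset)
  {
    assume "P \<inter> \<Inter>S \<noteq> {}"
    then obtain v where v: "v extreme_point_of P" "S \<subseteq> vertex_facets P v"
      using ex_extreme_point_Int_facets[OF P S] by blast
    \<comment> \<open>For \<open>n = 0\<close> the intersection of the empty set of facets would be the whole space instead of \<open>{v}\<close>.\<close>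
    have "n \<noteq> 0"
    proof
      assume "n = 0"
      then have "aff_dim P = 0" using P by (simp add: simple_polytope_def)
      then have "facets P = {}" by (auto simp: facets_def facet_of_def aff_dim_empty)
      then show False using card by simp
    qed
    then have "vertex_facets P v \<noteq> {}" using card_vertex_facets[OF P v(1)] by auto
    then have "\<Inter>(vertex_facets P v) \<subseteq> P" using in_P vertex_facets_subset by blast
    then have "\<Inter>(vertex_facets P v) = {v}" using Int_vertex_facets[OF P v(1)] by blast
    then have "c \<in> convex hull (f ` (facets P - vertex_facets P v))"
      using vertex[OF vertex_facets_subset card_vertex_facets[OF P v(1)]] v(1) by blast
    moreover have "f ` (facets P - vertex_facets P v) \<subseteq> f ` (facets P - S)" using v(2) by blast
    ultimately show "c \<in> convex hull (f ` (facets P - S))" using hull_mono by blast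
  }
  {
    assume c: "c \<in> convex hull (f ` (facets P - S))"
    then obtain W where W: "finite W" "W \<subseteq> f ` (facets P - S)" "card W \<le> 3" "c \<in> convex hull W"
      unfolding caratheodory[of "f ` (facets P - S)"] by auto
    obtain V where V: "V \<subseteq> facets P - S" "W = f ` V" "card V = card W"
      using W(2) unfolding subset_image_inj by (metis card_image)
    have "W \<subseteq> w ` {..<2 * k - 1}" using W(2) im by blast
    then obtain U where U: "U \<subseteq> {..<2 * k - 1}" "W = w ` U" "card U = card W"
      unfolding subset_image_inj by (metis card_image)
    have "card W = 3"
      using two_vertices_miss_center[OF reg k U(1)] W(3,4) U(2,3) by force
    then have V3: "card V = 3" using V(3) by simp
    have VF: "V \<subseteq> facets P" using V(1) by blast
    have "card (facets P - V) = n"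
      using card V3 VF finite_subset[OF VF fin] by (simp add: card_Diff_subset)
    moreover have "facets P - (facets P - V) = V" using VF by blast
    ultimately obtain v where v: "v extreme_point_of P" "\<Inter>(facets P - V) = {v}"
      using vertex[of "facets P - V"] W(4) V(2) by auto
    have "v \<in> P" using v(1) by (simp add: extreme_point_of_def)
    moreover have "S \<subseteq> facets P - V" using S V(1) by blast
    then have "v \<in> \<Inter>S" using v(2) by blast
    ultimately show "P \<inter> \<Inter>S \<noteq> {}" by blast
  }
qed

theorem proposition9:
  fixes P :: "'a::euclidean_space set"
    and n k :: nat and a :: "nat \<Rightarrow> nat" and l :: "'a \<Rightarrow> real" and t :: real
  assumes "simple_polytope n P"
    and "card (facets P) = n + 3"
    and "k \<ge> 2"
    and "has_polygon_type n k a P"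
    and "edge_generic P l"
    and "t \<noteq> 1"
  shows "poly (h_polynomial n P l) t =
    1 / (t - 1) ^ 3 *
      (t ^ (n + 3) - (\<Sum>i<2 * k - 1. t ^ psi k a i) + (\<Sum>i<2 * k - 1. t ^ phi k a i) - 1)"
proof -
  note P = assms(1) and card = assms(2) and k = assms(3)
  let ?m = "2 * k - 1" and ?A = "facets P"
  obtain c w f where rep: "polygon_representation n k P c w f"
    and a: "\<And>i. i < ?m \<Longrightarrow> a i = card {F \<in> ?A. f F = w i}"
    using assms(4) by (auto simp: has_polygon_type_def)
  have reg: "regular_polygon ?m c w" and im: "f ` ?A = w ` {..<?m}"
    using rep by (auto simp: polygon_representation_def)
  have fin: "finite ?A" using P by (rule finite_facets)
  define g where "g F = the_inv_into {..<?m} w (f F)" for F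
  have inj: "inj_on w {..<?m}" using reg by (rule regular_polygon_inj)
  have g: "g F < ?m" "w (g F) = f F" if "F \<in> ?A" for F
  proof -
    have "f F \<in> w ` {..<?m}" using im that by blast
    then show "g F < ?m" "w (g F) = f F"
      unfolding g_def using the_inv_into_into[OF inj _ order_refl] f_the_inv_into_f[OF inj] by auto
  qed
  have a_card: "card {F \<in> ?A. g F = i} = a i" if i: "i < ?m" for i
  proof -
    have "g F = i \<longleftrightarrow> f F = w i" if "F \<in> ?A" for F
      using g[OF that] inj i by (auto dest: inj_onD)
    then show ?thesis unfolding a[OF i] by (intro arg_cong[where f = card]) auto
  qed
  have arc_card: "card {F \<in> ?A. g F \<in> cyclic_arc ?m r i} = (\<Sum>s<r. a ((i + s) mod ?m))"
    if "r \<le> ?m" for r i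
    unfolding card_vimage_cyclic_arc[OF fin that] using k by (intro sum.cong a_card) auto

  have hull: "c \<in> convex hull (f ` T) \<longleftrightarrow> \<not> (\<exists>i<?m. g ` T \<subseteq> cyclic_arc ?m k i)"
    if T: "T \<subseteq> ?A" for T
  proof -
    have "f ` T = w ` g ` T" using g(2) T by (force simp: image_image)
    moreover have "g ` T \<subseteq> {..<?m}" using g(1) T by auto
    ultimately show ?thesis using center_in_hull_iff[OF reg, of "g ` T"] k by simp
  qed

  have "(t - 1) ^ 3 * poly (h_polynomial n P l) t =
      (\<Sum>S | S \<subseteq> ?A \<and> P \<inter> \<Inter>S \<noteq> {}. (t - 1) ^ (n + 3 - card S))"
    unfolding poly_h_polynomial_faces[OF P assms(5)] sum_distrib_left
  proof (rule sum.cong[OF refl])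
    fix S assume "S \<in> {S. S \<subseteq> ?A \<and> P \<inter> \<Inter>S \<noteq> {}}"
    then obtain v where v: "v extreme_point_of P" "S \<subseteq> vertex_facets P v"
      using ex_extreme_point_Int_facets[OF P] by blast
    then have "card S \<le> n"
      using card_mono[OF finite_vertex_facets[OF P] v(2)] card_vertex_facets[OF P v(1)] by simp
    then have "n + 3 - card S = 3 + (n - card S)" by simp
    then show "(t - 1) ^ 3 * (t - 1) ^ (n - card S) = (t - 1) ^ (n + 3 - card S)"
      by (simp only: power_add)
  qed
  also have "\<dots> = (\<Sum>T | T \<subseteq> ?A \<and> c \<in> convex hull (f ` T). (t - 1) ^ card T)"
  proof (rule sum.reindex_bij_witness[where i = "\<lambda>T. ?A - T" and j = "\<lambda>S. ?A - S"])
    fix S assume "S \<in> {S. S \<subseteq> ?A \<and> P \<inter> \<Inter>S \<noteq> {}}"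
    then have S: "S \<subseteq> ?A" "P \<inter> \<Inter>S \<noteq> {}" by auto
    show "?A - (?A - S) = S" using S(1) by blast
    show "?A - S \<in> {T. T \<subseteq> ?A \<and> c \<in> convex hull (f ` T)}"
      using nonempty_face_iff_center_in_hull[OF P card k rep S(1)] S(2) by blast
    show "(t - 1) ^ card (?A - S) = (t - 1) ^ (n + 3 - card S)"
      using S(1) fin card by (simp add: card_Diff_subset finite_subset)
  next
    fix T assume "T \<in> {T. T \<subseteq> ?A \<and> c \<in> convex hull (f ` T)}"
    then have T: "T \<subseteq> ?A" "c \<in> convex hull (f ` T)" by auto
    show eq: "?A - (?A - T) = T" using T(1) by blast
    show "?A - T \<in> {S. S \<subseteq> ?A \<and> P \<inter> \<Inter>S \<noteq> {}}"
      using nonempty_face_iff_center_in_hull[OF P card k rep, of "?A - T"] T(2) unfolding eq by blast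
  qed
  also have "{T. T \<subseteq> ?A \<and> c \<in> convex hull (f ` T)} =
      Pow ?A - {T. T \<subseteq> ?A \<and> (\<exists>i<?m. g ` T \<subseteq> cyclic_arc ?m k i)}"
    using hull by blast
  also have "(\<Sum>T\<in>\<dots>. (t - 1) ^ card T) = (\<Sum>T\<in>Pow ?A. (t - 1) ^ card T) -
      (\<Sum>T | T \<subseteq> ?A \<and> (\<exists>i<?m. g ` T \<subseteq> cyclic_arc ?m k i). (t - 1) ^ card T)"
    using fin by (intro sum_diff) auto
  also have "(\<Sum>T\<in>Pow ?A. (t - 1) ^ card T) = t ^ (n + 3)"
    using sum_power_card_Pow[OF fin, of "t - 1"] card by simp
  also have "(\<Sum>T | T \<subseteq> ?A \<and> (\<exists>i<?m. g ` T \<subseteq> cyclic_arc ?m k i). (t - 1) ^ card T) =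
      1 + (\<Sum>i<?m. t ^ psi k a i - t ^ phi k a (Suc i))"
  proof -
    have "g ` ?A \<subseteq> {..<?m}" using g(1) by auto
    then have "(\<Sum>T | T \<subseteq> ?A \<and> (\<exists>i<?m. g ` T \<subseteq> cyclic_arc ?m k i). (t - 1) ^ card T) =
      1 + (\<Sum>i<?m. (1 + (t - 1)) ^ card {F \<in> ?A. g F \<in> cyclic_arc ?m k i} -
                   (1 + (t - 1)) ^ card {F \<in> ?A. g F \<in> cyclic_arc ?m (k - 1) (Suc i)})"
      using k by (intro sum_power_card_in_arc[OF fin]) auto
    moreover have "card {F \<in> ?A. g F \<in> cyclic_arc ?m k i} = psi k a i" for i
      using arc_card[of k i] psi_shift[of k a i] k by simp
    moreover have "card {F \<in> ?A. g F \<in> cyclic_arc ?m (k - 1) i} = phi k a i" for i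
      using arc_card[of "k - 1" i] phi_shift[OF k, of a i] k by simp
    ultimately show ?thesis by simp
  qed
  also have "(\<Sum>i<?m. t ^ psi k a i - t ^ phi k a (Suc i)) =
      (\<Sum>i<?m. t ^ psi k a i) - (\<Sum>i<?m. t ^ phi k a i)"
    unfolding sum_subtractf sum_phi_Suc[OF k] ..
  finally have "(t - 1) ^ 3 * poly (h_polynomial n P l) t =
      t ^ (n + 3) - (\<Sum>i<?m. t ^ psi k a i) + (\<Sum>i<?m. t ^ phi k a i) - 1"
    by simp
  moreover have "(t - 1) ^ 3 \<noteq> 0" using assms(6) by simp
  ultimately show ?thesis by (simp add: field_simps)
qed

end
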